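(* Let $p\in(1,+\infty)$ and let $\Lambda=(\lambda_n)_{n\in\mathbb N}$ be an increasing sequence of non-negative real numbers with $\sum_{n\ge1}\frac1{\lambda_n}<+\infty$ and $\inf_n(\lambda_{n+1}-\lambda_n)>0$. The following are equivalent: (i) $\Lambda$ is super-lacunary; (ii) the sequence $\Big(\dfrac{t^{\lambda_n}}{\|t^{\lambda_n}\|_p}\Big)_n$ in $L^p$ is asymptotically isometric to the canonical basis of $\ell^p$.
   Context: $L^p=L^p([0,1],m)$ with $m$ the Lebesgue measure and norm $\|\cdot\|_p$. A sequence $(u_n)_n$ is super-lacunary if $u_{n+1}/u_n\to+\infty$. $c_{00}$ is the space of complex sequences with finitely many non-zero terms. A (normalized) sequence $(x_n)$ in a Banach space $X$ is asymptotically isometric to the canonical basis of $\ell^p$ if for every $\varepsilon\in(0,1)$ there exists an integer $N$ such that for any $a=(a_n)_n\in c_{00}$, $$(1-\varepsilon)\Big(\sum_{n\ge N}|a_n|^p\Big)^{1/p}\le\Big\|\sum_{n\ge N}a_nx_n\Big\|_X\le(1+\varepsilon)\Big(\sum_{n\ge N}|a_n|^p\Big)^{1/p}.$$ *)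

theory Defs
  imports "HOL-Analysis.Analysis"
begin

text \<open>
  \<open>L\<^sup>p\<close>-spaces are represented by their \<open>p\<close>-integrable functions (not identified almost
  everywhere), so \<open>Lp_norm\<close> is a norm only up to null functions.
\<close>

definition Lp_space :: "real \<Rightarrow> 'a measure \<Rightarrow> ('a \<Rightarrow> complex) set" where
  "Lp_space p M =
     {f. f \<in> borel_measurable M \<and> integrable M (\<lambda>x. norm (f x) powr p)}"

definition Lp_norm :: "real \<Rightarrow> 'a measure \<Rightarrow> ('a \<Rightarrow> complex) \<Rightarrow> real" where
  "Lp_norm p M f = (\<integral>x. norm (f x) powr p \<partial>M) powr (1 / p)"

definition super_lacunary :: "(nat \<Rightarrow> real) \<Rightarrow> bool" where
  "super_lacunary u \<longleftrightarrow> filterlim (\<lambda>n. u (Suc n) / u n) at_top sequentially"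

definition c00 :: "(nat \<Rightarrow> complex) set" where
  "c00 = {a. finite {n. a n \<noteq> 0}}"

text \<open>
  \<open>X\<close> is a space of complex functions with norm \<open>nrm\<close>; the sums over \<open>n \<ge> N\<close> are restricted
  to the (finite) support of \<open>a\<close>.
\<close>

definition asymptotically_isometric_lp ::
  "real \<Rightarrow> ('a \<Rightarrow> complex) set \<Rightarrow> (('a \<Rightarrow> complex) \<Rightarrow> real) \<Rightarrow> (nat \<Rightarrow> 'a \<Rightarrow> complex) \<Rightarrow> bool"
where
  "asymptotically_isometric_lp p X nrm x \<longleftrightarrow>
     (\<forall>n. x n \<in> X \<and> nrm (x n) = 1) \<and>
     (\<forall>\<epsilon>\<in>{0<..<1}. \<exists>N. \<forall>a\<in>c00.
        (1 - \<epsilon>) * (\<Sum>n | N \<le> n \<and> a n \<noteq> 0. norm (a n) powr p) powr (1 / p)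
          \<le> nrm (\<lambda>t. \<Sum>n | N \<le> n \<and> a n \<noteq> 0. a n * x n t) \<and>
        nrm (\<lambda>t. \<Sum>n | N \<le> n \<and> a n \<noteq> 0. a n * x n t)
          \<le> (1 + \<epsilon>) * (\<Sum>n | N \<le> n \<and> a n \<noteq> 0. norm (a n) powr p) powr (1 / p))"

text \<open>
  For \<open>r = 0\<close> this differs from the constant function \<open>1\<close> only at \<open>t = 0\<close>, since
  \<open>0 powr 0 = 0\<close>; the two agree almost everywhere.
\<close>

definition monomial :: "real \<Rightarrow> real \<Rightarrow> complex" where
  "monomial r = (\<lambda>t. complex_of_real (t powr r))"

definition normalized_monomial :: "real \<Rightarrow> real \<Rightarrow> real \<Rightarrow> complex" where
  "normalized_monomial p r =
     (\<lambda>t. monomial r t / complex_of_real (Lp_norm p (lebesgue_on {0..1}) (monomial r)))"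

end

theory Submission
  imports Defs
begin

text \<open>
  Write \<open>f\<^sub>n\<close> for the normalized monomials and \<open>\<mu>\<^sub>n = p \<lambda>\<^sub>n + 1\<close>, so that the measure
  \<open>|f\<^sub>n|\<^sup>p dt\<close> gives \<open>[0, c]\<close> the mass \<open>c\<close> to the power \<open>\<mu>\<^sub>n\<close>.

  If \<open>\<Lambda>\<close> is super-lacunary, cut the unit interval at the points \<open>exp (- 1 / sqrt (\<mu>\<^sub>m \<mu>\<^sub>m\<^sub>+\<^sub>1))\<close>.
  The \<open>n\<close>-th measure gives the \<open>m\<close>-th piece a mass that decays geometrically in \<open>|n - m|\<close>,
  with a ratio that tends to 0 far out. Hence, by Schur's test, \<open>\<Sum> a\<^sub>n f\<^sub>n\<close> is a small perturbation
  of a sum of disjointly supported functions. (Summing the errors \<open>\<parallel>f\<^sub>n - f\<^sub>n 1\<^bsub>A\<^sub>n\<^esub>\<parallel>\<close> would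
  not do: they need not be summable if the ratios grow slowly.)

  Conversely, \<open>p > 1\<close> and positivity give
  \<open>\<parallel>f\<^sub>n + f\<^sub>n\<^sub>+\<^sub>1\<parallel>\<^sup>p \<ge> 2 + C \<mu>\<^sub>n / \<mu>\<^sub>n\<^sub>+\<^sub>1\<close> with \<open>C > 0\<close>, so an asymptotic isometry forces
  \<open>\<mu>\<^sub>n / \<mu>\<^sub>n\<^sub>+\<^sub>1 \<rightarrow> 0\<close>.
\<close>

section \<open>Minkowski's inequality and almost disjoint functions\<close>

text \<open>Jensen's inequality for the power \<open>p\<close>, with weights \<open>w i / v\<close>
  at the points \<open>v * x i / w i\<close>, where \<open>v\<close> is the total weight. The
  \<open>w i\<close> stay free because Minkowski's inequality and Schur's test below need different
  choices.\<close>

lemma powr_sum_le_weighted: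
  fixes x w :: "'i \<Rightarrow> real"
  assumes "1 \<le> p" and S: "finite S"
    and w: "\<And>i. i \<in> S \<Longrightarrow> 0 < w i" and x: "\<And>i. i \<in> S \<Longrightarrow> 0 \<le> x i"
  shows "(\<Sum>i\<in>S. x i) powr p \<le> (\<Sum>i\<in>S. w i) powr (p - 1) * (\<Sum>i\<in>S. w i powr (1 - p) * x i powr p)"
proof -
  \<comment> \<open>Zero terms are set aside so that Jensen is applied at positive points only; they
    return in the last steps.\<close>
  define T where "T = {i\<in>S. x i \<noteq> 0}"
  have T: "finite T" "T \<subseteq> S" using S by (auto simp: T_def)
  show ?thesis
  proof (cases "T = {}")
    case True
    then have "(\<Sum>i\<in>S. x i) = 0" by (intro sum.neutral) (auto simp: T_def)
    then show ?thesis by (simp add: sum_nonneg)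
  next
    case False
    define v where "v = (\<Sum>i\<in>T. w i)"
    have v: "v > 0" unfolding v_def using T False w by (intro sum_pos) auto
    have wT: "w i > 0" "x i > 0" if "i \<in> T" for i
      using that w x T by (auto simp: T_def order_le_less)
    have "(\<Sum>i\<in>T. (w i / v) *\<^sub>R (v * x i / w i)) powr p
        \<le> (\<Sum>i\<in>T. (w i / v) * (v * x i / w i) powr p)"
    proof (rule convex_on_sum[OF T(1) False powr_convex[OF \<open>1 \<le> p\<close>]])
      show "(\<Sum>i\<in>T. w i / v) = 1"
        using v by (simp add: v_def flip: sum_divide_distrib)
    qed (use wT v in \<open>auto intro: less_imp_le\<close>)
    also have "(\<Sum>i\<in>T. (w i / v) *\<^sub>R (v * x i / w i)) = (\<Sum>i\<in>T. x i)"
      using wT v by (intro sum.cong) (auto simp: less_imp_neq[symmetric])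
    also have "(\<Sum>i\<in>T. (w i / v) * (v * x i / w i) powr p)
        = v powr (p - 1) * (\<Sum>i\<in>T. w i powr (1 - p) * x i powr p)"
      unfolding sum_distrib_left
    proof (rule sum.cong[OF refl])
      fix i assume "i \<in> T"
      note i = wT[OF this]
      have "(v * x i / w i) powr p = v powr p * x i powr p / w i powr p"
        using i v by (simp add: powr_mult powr_divide)
      moreover have "v powr (p - 1) = v powr p / v" "w i powr (1 - p) = w i / w i powr p"
        using i v by (simp_all add: powr_diff)
      ultimately show "w i / v * (v * x i / w i) powr p = v powr (p - 1) * (w i powr (1 - p) * x i powr p)"
        by simp
    qed
    also have "\<dots> \<le> (\<Sum>i\<in>S. w i) powr (p - 1) * (\<Sum>i\<in>S. w i powr (1 - p) * x i powr p)"
      unfolding v_def using assms T w x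
      by (intro mult_mono powr_mono2 sum_mono2 sum_nonneg) (auto simp: less_imp_le)
    also have "(\<Sum>i\<in>T. x i) = (\<Sum>i\<in>S. x i)"
      using S by (intro sum.mono_neutral_left) (auto simp: T_def)
    finally show ?thesis .
  qed
qed

lemma Lp_normI:
  assumes "0 < p" "0 \<le> c" "(\<integral>x. norm (f x) powr p \<partial>M) \<le> c powr p"
  shows "Lp_norm p M f \<le> c"
proof -
  have "Lp_norm p M f \<le> (c powr p) powr (1/p)"
    unfolding Lp_norm_def using assms by (intro powr_mono2) (auto intro: integral_nonneg)
  then show ?thesis using assms by (simp add: powr_powr)
qed

lemma Lp_norm_powr:
  "0 < p \<Longrightarrow> Lp_norm p M f powr p = (\<integral>x. norm (f x) powr p \<partial>M)"
  by (simp add: Lp_norm_def powr_powr)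

lemma Lp_norm_nonneg [simp]: "0 \<le> Lp_norm p M f"
  by (simp add: Lp_norm_def)

lemma Lp_space_measurable [measurable_dest]: "f \<in> Lp_space p M \<Longrightarrow> f \<in> borel_measurable M"
  by (simp add: Lp_space_def)

lemma Lp_space_integrable: "f \<in> Lp_space p M \<Longrightarrow> integrable M (\<lambda>x. norm (f x) powr p)"
  by (simp add: Lp_space_def)

lemma Lp_space_add:
  assumes "1 \<le> p" "f \<in> Lp_space p M" "g \<in> Lp_space p M"
  shows "(\<lambda>x. f x + g x) \<in> Lp_space p M"
proof -
  note [measurable] = assms(2,3)[THEN Lp_space_measurable]
  have int: "integrable M (\<lambda>x. 2 powr (p - 1) * (norm (f x) powr p + norm (g x) powr p))"
    using assms by (auto intro!: integrable_add Lp_space_integrable)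
  \<comment> \<open>The weighted inequality with both weights 1 gives an integrable
    majorant.\<close>
  have bound: "norm (f x + g x) powr p \<le> 2 powr (p - 1) * (norm (f x) powr p + norm (g x) powr p)" for x
  proof -
    have "norm (f x + g x) powr p \<le> (norm (f x) + norm (g x)) powr p"
      using assms by (intro powr_mono2 norm_triangle_ineq) auto
    also have "\<dots> \<le> 2 powr (p - 1) * (norm (f x) powr p + norm (g x) powr p)"
      using powr_sum_le_weighted[of p "UNIV :: bool set" "\<lambda>_. 1" "\<lambda>b. if b then norm (f x) else norm (g x)"] assms
      by (simp add: UNIV_bool algebra_simps)
    finally show ?thesis .
  qed
  have "integrable M (\<lambda>x. norm (f x + g x) powr p)"
    by (rule Bochner_Integration.integrable_bound[OF int])
      (use bound in \<open>auto intro: order_trans[OF _ abs_ge_self]\<close>)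
  then show ?thesis by (simp add: Lp_space_def)
qed

lemma Lp_space_mult_left:
  assumes "f \<in> Lp_space p M"
  shows "(\<lambda>x. c * f x) \<in> Lp_space p M"
  using assms by (auto simp: Lp_space_def norm_mult powr_mult)

lemma Lp_space_zero: "0 < p \<Longrightarrow> (\<lambda>x. 0) \<in> Lp_space p M"
  by (simp add: Lp_space_def)

lemma Lp_space_sum:
  assumes "1 \<le> p" "\<And>i. i \<in> S \<Longrightarrow> f i \<in> Lp_space p M"
  shows "(\<lambda>x. \<Sum>i\<in>S. f i x) \<in> Lp_space p M"
  using assms(2)
  by (induction S rule: infinite_finite_induct)
    (use assms(1) in \<open>auto intro: Lp_space_add Lp_space_zero\<close>)

lemma Lp_space_indicator:
  assumes "0 < p" "f \<in> Lp_space p M" "A \<in> sets M"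
  shows "(\<lambda>x. indicator A x * f x) \<in> Lp_space p M"
proof -
  note [measurable] = assms(3) assms(2)[THEN Lp_space_measurable]
  have "integrable M (\<lambda>x. norm (indicator A x * f x) powr p)"
    by (rule Bochner_Integration.integrable_bound[OF Lp_space_integrable[OF assms(2)]])
      (auto simp: indicator_def norm_mult)
  then show ?thesis by (simp add: Lp_space_def)
qed

text \<open>Minkowski's inequality, with upper bounds in place of the norms so that estimates can be
  inserted directly.\<close>

lemma Lp_norm_triangle:
  assumes "1 \<le> p" "f \<in> Lp_space p M" "g \<in> Lp_space p M"
    and "Lp_norm p M f \<le> \<alpha>" "Lp_norm p M g \<le> \<beta>"
  shows "Lp_norm p M (\<lambda>x. f x + g x) \<le> \<alpha> + \<beta>"
proof (rule field_le_epsilon)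
  fix e :: real assume e: "0 < e"
  \<comment> \<open>Jensen with weights proportional to the two norms, enlarged to keep them positive\<close>
  define u where "u = \<alpha> + e/2"
  define v where "v = \<beta> + e/2"
  have u: "Lp_norm p M f \<le> u" "0 < u"
    using assms(4) e Lp_norm_nonneg[of p M f] unfolding u_def by linarith+
  have v: "Lp_norm p M g \<le> v" "0 < v"
    using assms(5) e Lp_norm_nonneg[of p M g] unfolding v_def by linarith+
  have f: "(\<integral>x. norm (f x) powr p \<partial>M) \<le> u powr p"
    using u assms powr_mono2[of p "Lp_norm p M f" u] by (simp add: Lp_norm_powr)
  have g: "(\<integral>x. norm (g x) powr p \<partial>M) \<le> v powr p"
    using v assms powr_mono2[of p "Lp_norm p M g" v] by (simp add: Lp_norm_powr)
  have "norm (f x + g x) powr p \<le> (u + v) powr (p - 1) *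
      (u powr (1 - p) * norm (f x) powr p + v powr (1 - p) * norm (g x) powr p)" for x
  proof -
    have "norm (f x + g x) powr p \<le> (norm (f x) + norm (g x)) powr p"
      using assms by (intro powr_mono2 norm_triangle_ineq) auto
    also have "\<dots> \<le> (u + v) powr (p - 1) *
      (u powr (1 - p) * norm (f x) powr p + v powr (1 - p) * norm (g x) powr p)"
      using powr_sum_le_weighted[of p "UNIV :: bool set" "\<lambda>b. if b then u else v"
          "\<lambda>b. if b then norm (f x) else norm (g x)"] assms u v
      by (simp add: UNIV_bool algebra_simps)
    finally show ?thesis .
  qed
  then have "(\<integral>x. norm (f x + g x) powr p \<partial>M) \<le> (\<integral>x. (u + v) powr (p - 1) *
      (u powr (1 - p) * norm (f x) powr p + v powr (1 - p) * norm (g x) powr p) \<partial>M)"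
    by (intro integral_mono Lp_space_integrable[OF Lp_space_add[OF assms(1-3)]]
        integrable_mult_right Bochner_Integration.integrable_add Lp_space_integrable assms) 
  also have "\<dots> = (u + v) powr (p - 1) * (u powr (1 - p) * (\<integral>x. norm (f x) powr p \<partial>M)
      + v powr (1 - p) * (\<integral>x. norm (g x) powr p \<partial>M))"
    using Lp_space_integrable[OF assms(2)] Lp_space_integrable[OF assms(3)] by simp
  also have "\<dots> \<le> (u + v) powr (p - 1) * (u powr (1 - p) * u powr p + v powr (1 - p) * v powr p)"
    using f g by (intro mult_left_mono add_mono) auto
  also have "\<dots> = (u + v) powr p"
    using u v by (simp add: powr_diff field_simps)
  finally have "Lp_norm p M (\<lambda>x. f x + g x) \<le> u + v"
    using u v assms by (intro Lp_normI) auto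
  then show "Lp_norm p M (\<lambda>x. f x + g x) \<le> \<alpha> + \<beta> + e" by (simp add: u_def v_def)
qed

text \<open>The sum \<open>F\<close> is split as \<open>g + h\<close>, where \<open>g\<close> keeps
  only the part of each \<open>f n\<close> on its own piece \<open>A n\<close>. Disjointness and the
  masses place the norm of \<open>g\<close> between \<open>(1 - W) * R\<close> and \<open>R\<close>;
  Schur's test bounds that of \<open>h\<close> by \<open>W * R\<close>. Hence the loss
  \<open>W\<close> above and \<open>2 * W\<close> below. The bound in \<open>off\<close> is a
  \<open>p\<close>-th power so that the factors \<open>w n m powr (1 - p)\<close> from Jensen
  combine with it to \<open>w n m\<close>, which has controlled row and column sums.\<close>

lemma Lp_norm_almost_disjoint:
  fixes f :: "'i \<Rightarrow> 'a \<Rightarrow> complex" and a :: "'i \<Rightarrow> complex" and w :: "'i \<Rightarrow> 'i \<Rightarrow> real"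
  assumes p: "1 \<le> p" and S: "finite S"
    and A: "\<And>m. m \<in> S \<Longrightarrow> A m \<in> sets M" "disjoint_family_on A S" "(\<Union>m\<in>S. A m) = space M"
    and f: "\<And>n. n \<in> S \<Longrightarrow> f n \<in> Lp_space p M" "\<And>n. n \<in> S \<Longrightarrow> (\<integral>x. norm (f n x) powr p \<partial>M) = 1"
    and off: "\<And>n m. n \<in> S \<Longrightarrow> m \<in> S \<Longrightarrow> n \<noteq> m \<Longrightarrow>
      (\<integral>x. indicator (A m) x * norm (f n x) powr p \<partial>M) \<le> w n m powr p"
    and w: "\<And>n m. 0 < w n m" "\<And>n m. w n m \<le> 1"
    and row: "\<And>n. n \<in> S \<Longrightarrow> (\<Sum>m\<in>S-{n}. w n m) \<le> W"
    and col: "\<And>m. m \<in> S \<Longrightarrow> (\<Sum>n\<in>S-{m}. w n m) \<le> W"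
    and W: "0 < W" "W \<le> 1"
  defines "R \<equiv> (\<Sum>n\<in>S. norm (a n) powr p) powr (1/p)"
  shows "(1 - 2 * W) * R \<le> Lp_norm p M (\<lambda>x. \<Sum>n\<in>S. a n * f n x)"
    and "Lp_norm p M (\<lambda>x. \<Sum>n\<in>S. a n * f n x) \<le> (1 + W) * R"
proof -
  define F where "F = (\<lambda>x. \<Sum>n\<in>S. a n * f n x)"
  define g where "g = (\<lambda>x. \<Sum>n\<in>S. indicator (A n) x * (a n * f n x))"
  define h where "h = (\<lambda>x. F x + (- 1) * g x)"
  note [measurable] = A(1)
  have FL: "F \<in> Lp_space p M" unfolding F_def
    by (intro Lp_space_sum p Lp_space_mult_left f)
  have gL: "g \<in> Lp_space p M" unfolding g_def
    using p by (intro Lp_space_sum Lp_space_indicator Lp_space_mult_left f A) auto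
  have hL: "h \<in> Lp_space p M" unfolding h_def
    by (intro Lp_space_add Lp_space_mult_left p FL gL)
  \<comment> \<open>The type \<open>'b\<close> stays general: the fact serves real indicators (for
    the masses) and complex ones (in \<open>g\<close>).\<close>
  have ind: "indicator (A n) x = (if n = m then 1 else 0 :: 'b :: zero_neq_one)"
    if "m \<in> S" "n \<in> S" "x \<in> A m" for n m x
    using that A(2) by (auto simp: indicator_def disjoint_family_on_def)
  have R: "R powr p = (\<Sum>n\<in>S. norm (a n) powr p)" "0 \<le> R"
    using p unfolding R_def by (auto simp: powr_powr sum_nonneg)
  have int_ind: "integrable M (\<lambda>x. indicator B x * norm (u x) powr p)"
    if "u \<in> Lp_space p M" "B \<in> sets M" for u B
    using integrable_mult_indicator[OF that(2) Lp_space_integrable[OF that(1)]] by simp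
  have split: "(\<integral>x. norm (u x) powr p \<partial>M) = (\<Sum>m\<in>S. \<integral>x. indicator (A m) x * norm (u x) powr p \<partial>M)"
    if "u \<in> Lp_space p M" for u
  proof -
    have "(\<Sum>m\<in>S. \<integral>x. indicator (A m) x * norm (u x) powr p \<partial>M)
        = (\<integral>x. (\<Sum>m\<in>S. indicator (A m) x * norm (u x) powr p) \<partial>M)"
      using that A(1) by (intro Bochner_Integration.integral_sum[symmetric] int_ind)
    also have "\<dots> = (\<integral>x. norm (u x) powr p \<partial>M)"
    proof (rule Bochner_Integration.integral_cong[OF refl])
      fix x assume "x \<in> space M"
      then obtain m where m: "m \<in> S" "x \<in> A m" using A(3) by blast
      have "(\<Sum>k\<in>S. indicator (A k) x * norm (u x) powr p) = (\<Sum>k\<in>S. if k = m then norm (u x) powr p else 0)"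
        using m by (intro sum.cong) (auto simp: ind[OF m(1) _ m(2)])
      then show "(\<Sum>k\<in>S. indicator (A k) x * norm (u x) powr p) = norm (u x) powr p"
        using m S by simp
    qed
    finally show ?thesis ..
  qed
  have g_eq: "g x = a m * f m x" if "m \<in> S" "x \<in> A m" for m x
  proof -
    have "g x = (\<Sum>k\<in>S. if k = m then a m * f m x else 0)"
      unfolding g_def using that by (intro sum.cong) (auto simp: ind[OF that(1) _ that(2)])
    then show ?thesis using that S by simp
  qed
  have h_eq: "h x = (\<Sum>n\<in>S-{m}. a n * f n x)" if "m \<in> S" "x \<in> A m" for m x
    unfolding h_def g_eq[OF that] F_def using that S by (simp add: sum.remove[of S m])

  \<comment> \<open>Each \<open>f m\<close> has total mass 1, and what lies outside
    \<open>A m\<close> is at most the row sum of \<open>w m k powr p\<close>, hence of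
    \<open>w m k\<close>, as \<open>w m k \<le> 1 \<le> p\<close>.\<close>
  have diag: "1 - W \<le> (\<integral>x. indicator (A m) x * norm (f m x) powr p \<partial>M)"
    "(\<integral>x. indicator (A m) x * norm (f m x) powr p \<partial>M) \<le> 1" if m: "m \<in> S" for m
  proof -
    have "1 = (\<Sum>k\<in>S. \<integral>x. indicator (A k) x * norm (f m x) powr p \<partial>M)"
      using split[OF f(1)[OF m]] f(2)[OF m] by simp
    also have "\<dots> = (\<integral>x. indicator (A m) x * norm (f m x) powr p \<partial>M)
        + (\<Sum>k\<in>S-{m}. \<integral>x. indicator (A k) x * norm (f m x) powr p \<partial>M)"
      using m S by (simp add: sum.remove)
    finally have eq: "1 = (\<integral>x. indicator (A m) x * norm (f m x) powr p \<partial>M)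
        + (\<Sum>k\<in>S-{m}. \<integral>x. indicator (A k) x * norm (f m x) powr p \<partial>M)" .
    have "(\<Sum>k\<in>S-{m}. \<integral>x. indicator (A k) x * norm (f m x) powr p \<partial>M) \<le> (\<Sum>k\<in>S-{m}. w m k)"
    proof (rule sum_mono)
      fix k assume k: "k \<in> S - {m}"
      have "w m k powr p \<le> w m k powr 1"
        using w[of m k] p by (intro powr_mono') (auto intro: less_imp_le)
      then show "(\<integral>x. indicator (A k) x * norm (f m x) powr p \<partial>M) \<le> w m k"
        using off[of m k] k m w(1)[of m k] by auto
    qed
    with row[OF m] eq show "1 - W \<le> (\<integral>x. indicator (A m) x * norm (f m x) powr p \<partial>M)" by linarith
    have "0 \<le> (\<Sum>k\<in>S-{m}. \<integral>x. indicator (A k) x * norm (f m x) powr p \<partial>M)"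
      by (intro sum_nonneg Bochner_Integration.integral_nonneg) auto
    with eq show "(\<integral>x. indicator (A m) x * norm (f m x) powr p \<partial>M) \<le> 1" by linarith
  qed
  have g_int: "(\<integral>x. norm (g x) powr p \<partial>M)
      = (\<Sum>m\<in>S. norm (a m) powr p * (\<integral>x. indicator (A m) x * norm (f m x) powr p \<partial>M))"
    unfolding split[OF gL]
  proof (rule sum.cong[OF refl])
    fix m assume m: "m \<in> S"
    have "(\<integral>x. indicator (A m) x * norm (g x) powr p \<partial>M)
       = (\<integral>x. norm (a m) powr p * (indicator (A m) x * norm (f m x) powr p) \<partial>M)"
      using m by (intro Bochner_Integration.integral_cong)
        (auto simp: g_eq norm_mult powr_mult indicator_def)
    then show "(\<integral>x. indicator (A m) x * norm (g x) powr p \<partial>M)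
       = norm (a m) powr p * (\<integral>x. indicator (A m) x * norm (f m x) powr p \<partial>M)" by simp
  qed
  have "(\<integral>x. norm (g x) powr p \<partial>M) \<le> (\<Sum>m\<in>S. norm (a m) powr p * 1)"
    unfolding g_int using diag(2) by (intro sum_mono mult_left_mono) auto
  then have g_le: "Lp_norm p M g \<le> R"
    using p R by (intro Lp_normI) auto
  have "(\<Sum>m\<in>S. norm (a m) powr p * (1 - W)) \<le> (\<integral>x. norm (g x) powr p \<partial>M)"
    unfolding g_int using diag(1) by (intro sum_mono mult_left_mono) auto
  then have "(1 - W) * R powr p \<le> Lp_norm p M g powr p"
    using p by (simp add: R Lp_norm_powr sum_distrib_left mult.commute)
  \<comment> \<open>Replacing \<open>1 - W\<close> by its smaller \<open>p\<close>-th power allows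
    taking the root while keeping the constant linear in \<open>W\<close>.\<close>
  moreover have "(1 - W) powr p \<le> (1 - W)"
    using powr_mono'[of 1 p "1 - W"] p W by (auto simp: powr_le1)
  ultimately have "((1 - W) * R) powr p \<le> Lp_norm p M g powr p"
    using W R(2) mult_right_mono[of "(1 - W) powr p" "1 - W" "R powr p"] by (simp add: powr_mult)
  then have g_ge: "(1 - W) * R \<le> Lp_norm p M g"
    using p powr_less_mono2[of p "Lp_norm p M g" "(1 - W) * R"] by (meson Lp_norm_nonneg not_less less_le_trans zero_less_one)

  \<comment> \<open>Schur's test: Jensen with the weights \<open>w n m\<close> on each piece \<open>A m\<close>, then summation over \<open>m\<close>\<close>
  have h_loc: "(\<integral>x. indicator (A m) x * norm (h x) powr p \<partial>M)
      \<le> W powr (p - 1) * (\<Sum>n\<in>S-{m}. w n m * norm (a n) powr p)" if m: "m \<in> S" for m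
  proof -
    define V where "V = (\<Sum>n\<in>S-{m}. w n m)"
    have V: "0 \<le> V" "V \<le> W" unfolding V_def using col[OF m] by (auto intro!: sum_nonneg simp: w less_imp_le)
    have pt: "indicator (A m) x * norm (h x) powr p \<le> V powr (p - 1) *
        (\<Sum>n\<in>S-{m}. w n m powr (1 - p) * norm (a n) powr p * (indicator (A m) x * norm (f n x) powr p))" for x
    proof (cases "x \<in> A m")
      case True
      have "norm (h x) powr p \<le> (\<Sum>n\<in>S-{m}. norm (a n * f n x)) powr p"
        unfolding h_eq[OF m True] using p by (intro powr_mono2 norm_sum) auto
      also have "\<dots> \<le> V powr (p - 1) * (\<Sum>n\<in>S-{m}. w n m powr (1 - p) * norm (a n * f n x) powr p)"
        unfolding V_def using p S w by (intro powr_sum_le_weighted) auto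
      finally show ?thesis using True by (simp add: norm_mult powr_mult mult.assoc)
    qed simp
    have "(\<integral>x. indicator (A m) x * norm (h x) powr p \<partial>M) \<le> (\<integral>x. V powr (p - 1) *
        (\<Sum>n\<in>S-{m}. w n m powr (1 - p) * norm (a n) powr p * (indicator (A m) x * norm (f n x) powr p)) \<partial>M)"
      using m by (intro integral_mono pt integrable_mult_right Bochner_Integration.integrable_sum int_ind hL f A) auto
    also have "\<dots> = V powr (p - 1) * (\<Sum>n\<in>S-{m}. w n m powr (1 - p) * norm (a n) powr p *
        (\<integral>x. indicator (A m) x * norm (f n x) powr p \<partial>M))"
      using m by (simp add: Bochner_Integration.integral_sum int_ind f A)
    also have "\<dots> \<le> V powr (p - 1) * (\<Sum>n\<in>S-{m}. w n m powr (1 - p) * norm (a n) powr p * w n m powr p)"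
      using m by (intro mult_left_mono sum_mono off) auto
    also have "\<dots> = V powr (p - 1) * (\<Sum>n\<in>S-{m}. w n m * norm (a n) powr p)"
    proof -
      have "w n m powr (1 - p) * c * w n m powr p = w n m * c" for n c
        using w(1)[of n m] by (simp add: powr_diff)
      then show ?thesis by (simp only:)
    qed
    also have "\<dots> \<le> W powr (p - 1) * (\<Sum>n\<in>S-{m}. w n m * norm (a n) powr p)"
      using V p w by (intro mult_right_mono powr_mono2 sum_nonneg) (auto simp: less_imp_le)
    finally show ?thesis .
  qed
  have "(\<integral>x. norm (h x) powr p \<partial>M) \<le> (\<Sum>m\<in>S. W powr (p - 1) * (\<Sum>n\<in>S-{m}. w n m * norm (a n) powr p))"
    unfolding split[OF hL] by (intro sum_mono h_loc)
  also have "\<dots> = W powr (p - 1) * (\<Sum>m\<in>S. \<Sum>n\<in>S-{m}. w n m * norm (a n) powr p)"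
    by (simp add: sum_distrib_left)
  also have "(\<Sum>m\<in>S. \<Sum>n\<in>S-{m}. w n m * norm (a n) powr p)
      = (\<Sum>m\<in>S. \<Sum>n\<in>{n\<in>S. n \<noteq> m}. w n m * norm (a n) powr p)"
    by (intro sum.cong) auto
  also have "\<dots> = (\<Sum>n\<in>S. \<Sum>m\<in>{m\<in>S. n \<noteq> m}. w n m * norm (a n) powr p)"
    using S by (rule sum.swap_restrict) (rule S)
  also have "\<dots> = (\<Sum>n\<in>S. norm (a n) powr p * (\<Sum>m\<in>S-{n}. w n m))"
    by (auto simp: sum_distrib_left mult.commute intro!: sum.cong)
  also have "\<dots> \<le> (\<Sum>n\<in>S. norm (a n) powr p * W)"
    using row by (intro sum_mono mult_left_mono) auto
  also have "W powr (p - 1) * \<dots> = (W * R) powr p"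
    using W R by (simp add: powr_mult powr_diff flip: sum_distrib_right)
  finally have "(\<integral>x. norm (h x) powr p \<partial>M) \<le> (W * R) powr p"
    by (simp add: mult_left_mono)
  then have h_le: "Lp_norm p M h \<le> W * R"
    using p R W by (intro Lp_normI) auto

  have "Lp_norm p M (\<lambda>x. g x + h x) \<le> R + W * R"
    by (rule Lp_norm_triangle[OF p gL hL g_le h_le])
  moreover have "(\<lambda>x. g x + h x) = F" by (simp add: h_def)
  ultimately show "Lp_norm p M (\<lambda>x. \<Sum>n\<in>S. a n * f n x) \<le> (1 + W) * R"
    by (simp add: F_def algebra_simps)
  have mh: "Lp_norm p M (\<lambda>x. (- 1) * h x) \<le> W * R"
    using h_le by (simp add: Lp_norm_def)
  have "Lp_norm p M (\<lambda>x. F x + (- 1) * h x) \<le> Lp_norm p M F + W * R"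
    by (rule Lp_norm_triangle[OF p FL Lp_space_mult_left[OF hL] order_refl mh])
  moreover have "(\<lambda>x. F x + (- 1) * h x) = g" by (simp add: h_def)
  ultimately show "(1 - 2 * W) * R \<le> Lp_norm p M (\<lambda>x. \<Sum>n\<in>S. a n * f n x)"
    using g_ge by (simp add: F_def algebra_simps)
qed

section \<open>Normalized monomials on the unit interval\<close>

text \<open>The cut-off \<open>c\<close> lets one formula serve both initial segments and, with
  \<open>c = 1\<close>, the whole interval.\<close>

lemma has_bochner_integral_powr:
  assumes "0 \<le> r" "0 \<le> c" "c \<le> 1"
  shows "has_bochner_integral (lebesgue_on {0..1}) (\<lambda>t::real. indicator {0..c} t * t powr r)
    (c powr (r + 1) / (r + 1))"
proof -
  let ?f = "\<lambda>t::real. indicator {0..c} t * t powr r"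
  have "((\<lambda>t. if t \<in> {0..c} then t powr r else 0) has_integral (c powr (r + 1) / (r + 1))) {0..1}"
    using has_integral_powr_from_0[of r c] assms by (subst has_integral_restrict) auto
  moreover have "(\<lambda>t. if t \<in> {0..c} then t powr r else 0) = ?f" by (auto simp: fun_eq_iff)
  ultimately have *: "(?f has_integral (c powr (r + 1) / (r + 1))) {0..1}" by simp
  then have "integrable (lebesgue_on {0..1}) ?f"
    by (intro absolutely_integrable_imp_integrable nonnegative_absolutely_integrable_1)
      (auto simp: has_integral_integrable)
  then show ?thesis
    using * by (simp add: has_bochner_integral_iff lebesgue_integral_eq_integral integral_unique)
qed

lemma norm_monomial_powr: "norm (monomial r t) powr p = t powr (r * p)"
  by (simp add: monomial_def powr_powr)

lemma monomial_measurable: "monomial r \<in> borel_measurable (lebesgue_on {0..1})"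
proof -
  have "monomial r \<in> borel_measurable borel" unfolding monomial_def by measurable
  then show ?thesis
    by (intro measurable_restrict_space1 measurable_completion) simp
qed

lemma Lp_norm_monomial:
  assumes "0 < p" "0 \<le> r"
  shows "Lp_norm p (lebesgue_on {0..1}) (monomial r) = (1 / (r * p + 1)) powr (1 / p)"
proof -
  have "(\<integral>t. norm (monomial r t) powr p \<partial>lebesgue_on {0..1})
     = (\<integral>t. indicator {0..1} t * t powr (r * p) \<partial>lebesgue_on {0..1})"
    by (intro Bochner_Integration.integral_cong) (auto simp: norm_monomial_powr)
  also have "\<dots> = 1 / (r * p + 1)"
    using has_bochner_integral_powr[of "r * p" 1] assms by (simp add: has_bochner_integral_iff)
  finally show ?thesis by (simp add: Lp_norm_def)
qed

lemma norm_normalized_monomial_powr: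
  assumes "0 < p" "0 \<le> r"
  shows "norm (normalized_monomial p r t) powr p = (r * p + 1) * t powr (r * p)"
proof -
  have "r * p + 1 > 0" using assms by (simp add: add_nonneg_pos)
  then show ?thesis using assms unfolding normalized_monomial_def
    by (simp add: norm_divide powr_divide norm_mult powr_mult norm_monomial_powr Lp_norm_monomial powr_powr)
qed

lemma has_bochner_integral_normalized_monomial:
  assumes "0 < p" "0 \<le> r" "0 \<le> c" "c \<le> 1"
  shows "has_bochner_integral (lebesgue_on {0..1})
    (\<lambda>t. indicator {0..c} t * norm (normalized_monomial p r t) powr p) (c powr (r * p + 1))"
proof -
  have pos: "r * p + 1 > 0" using assms by (simp add: add_nonneg_pos)
  have "has_bochner_integral (lebesgue_on {0..1}) (\<lambda>t. (r * p + 1) * (indicator {0..c} t * t powr (r * p)))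
    ((r * p + 1) * (c powr (r * p + 1) / (r * p + 1)))"
    using assms by (intro has_bochner_integral_mult_right has_bochner_integral_powr) auto
  then show ?thesis using pos assms by (simp add: norm_normalized_monomial_powr mult.left_commute)
qed

lemma normalized_monomial_Lp:
  assumes "0 < p" "0 \<le> r"
  shows "normalized_monomial p r \<in> Lp_space p (lebesgue_on {0..1})"
    and "(\<integral>t. norm (normalized_monomial p r t) powr p \<partial>lebesgue_on {0..1}) = 1"
proof -
  have *: "has_bochner_integral (lebesgue_on {0..1}) (\<lambda>t. norm (normalized_monomial p r t) powr p) 1"
  proof (rule has_bochner_integral_cong[THEN iffD1])
    show "has_bochner_integral (lebesgue_on {0..1})
      (\<lambda>t. indicator {0..1} t * norm (normalized_monomial p r t) powr p) (1 powr (r * p + 1))"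
      using assms by (intro has_bochner_integral_normalized_monomial) auto
  qed auto
  then show "(\<integral>t. norm (normalized_monomial p r t) powr p \<partial>lebesgue_on {0..1}) = 1"
    by (simp add: has_bochner_integral_iff)
  note [measurable] = monomial_measurable
  have "normalized_monomial p r \<in> borel_measurable (lebesgue_on {0..1})"
    unfolding normalized_monomial_def by measurable
  with * show "normalized_monomial p r \<in> Lp_space p (lebesgue_on {0..1})"
    by (simp add: Lp_space_def has_bochner_integral_iff)
qed

text \<open>Subtraction on \<open>nat\<close> truncates, so \<open>(n - m) + (m - n)\<close> is the distance of \<open>n\<close> and \<open>m\<close>.\<close>

lemma sum_power_dist_le:
  fixes q :: real and S :: "nat set"
  assumes "0 < q" "q < 1" and S: "finite S"
  shows "(\<Sum>m\<in>S-{n}. q ^ ((n - m) + (m - n))) \<le> 2 * q / (1 - q)"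
proof -
  have geo: "(\<Sum>j\<in>T. q ^ Suc j) \<le> q / (1 - q)" if "finite T" for T
  proof -
    have "(\<Sum>j\<in>T. q ^ Suc j) = q * (\<Sum>j\<in>T. q ^ j)" by (simp add: sum_distrib_left)
    also have "\<dots> \<le> q * (1 / (1 - q))"
      using assms that sum_le_suminf[of "\<lambda>j. q ^ j" T]
      by (intro mult_left_mono) (auto simp: suminf_geometric summable_geometric)
    finally show ?thesis by simp
  qed
  have "(\<Sum>m\<in>S-{n}. q ^ ((n - m) + (m - n)))
      = (\<Sum>m\<in>S\<inter>{..<n}. q ^ ((n - m) + (m - n))) + (\<Sum>m\<in>S\<inter>{n<..}. q ^ ((n - m) + (m - n)))"
    using S by (subst sum.union_disjoint[symmetric]) (auto intro!: sum.cong)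
  \<comment> \<open>The new index is the distance minus one, which is injective on either side of
    \<open>n\<close>, so each side becomes a partial sum of a geometric series.\<close>
  also have "(\<Sum>m\<in>S\<inter>{..<n}. q ^ ((n - m) + (m - n))) = (\<Sum>j\<in>(\<lambda>m. n - Suc m) ` (S\<inter>{..<n}). q ^ Suc j)"
    by (subst sum.reindex) (auto intro!: sum.cong simp: inj_on_def Suc_diff_Suc simp del: power_Suc)
  also have "(\<Sum>m\<in>S\<inter>{n<..}. q ^ ((n - m) + (m - n))) = (\<Sum>j\<in>(\<lambda>m. m - Suc n) ` (S\<inter>{n<..}). q ^ Suc j)"
    by (subst sum.reindex) (auto intro!: sum.cong simp: inj_on_def Suc_diff_Suc simp del: power_Suc)
  finally show ?thesis
    using geo[of "(\<lambda>m. n - Suc m) ` (S\<inter>{..<n})"] geo[of "(\<lambda>m. m - Suc n) ` (S\<inter>{n<..})"] S by simp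
qed

section \<open>Partition of the unit interval and the masses of its pieces\<close>

lemma geometric_growth_le:
  fixes x :: "nat \<Rightarrow> real"
  assumes "\<And>k. N \<le> k \<Longrightarrow> x k \<le> \<kappa> * x (Suc k)" "0 \<le> \<kappa>" "N \<le> n" "n \<le> m"
  shows "x n \<le> \<kappa> ^ (m - n) * x m"
  using \<open>n \<le> m\<close>
proof (induction m rule: dec_induct)
  case (step m)
  have "\<kappa> ^ (m - n) * x m \<le> \<kappa> ^ (m - n) * (\<kappa> * x (Suc m))"
    using assms step by (intro mult_left_mono assms(1)) auto
  with step show ?case by (simp add: Suc_diff_le mult_ac)
qed simp

text \<open>With \<open>x n\<close> the root of \<open>p * lam n + 1\<close>, growth by the factor
  \<open>q powr -p\<close> makes the mass of the \<open>n\<close>-th function on the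
  \<open>m\<close>-th piece at most the \<open>p\<close>-th power of \<open>q ^ d\<close>, where
  \<open>d\<close> is the distance of \<open>n\<close> and \<open>m\<close>. The geometric series
  bounds the row and column sums of these weights by \<open>2 * q / (1 - q)\<close>.\<close>

lemma lacunary_monomials_almost_isometric:
  fixes lam x :: "nat \<Rightarrow> real" and a :: "nat \<Rightarrow> complex"
  assumes p: "1 < p" and lam: "\<And>n. 0 \<le> lam n"
    and x: "\<And>n. x n = sqrt (p * lam n + 1)"
    and q: "0 < q" "q < 1" "2 * q / (1 - q) \<le> W" "W \<le> 1"
    and growth: "\<And>n. N \<le> n \<Longrightarrow> x n \<le> q powr p * x (Suc n)"
    and "N < K"
  defines "R \<equiv> (\<Sum>n\<in>{N..<K}. norm (a n) powr p) powr (1/p)"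
  defines "nrm \<equiv> Lp_norm p (lebesgue_on {0..1}) (\<lambda>t. \<Sum>n\<in>{N..<K}. a n * normalized_monomial p (lam n) t)"
  shows "(1 - 2 * W) * R \<le> nrm" "nrm \<le> (1 + W) * R"
proof -
  define \<kappa> where "\<kappa> = q powr p"
  have \<kappa>: "0 < \<kappa>" "\<kappa> \<le> 1" using q p by (auto simp: \<kappa>_def powr_le1)
  have x1: "1 \<le> x n" for n unfolding x using lam[of n] p by simp
  then have x0: "0 < x n" for n using less_le_trans[OF zero_less_one] by blast
  have sq: "lam n * p + 1 = x n * x n" for n unfolding x using lam[of n] p by (simp add: mult.commute)
  have gr: "x n \<le> \<kappa> ^ (m - n) * x m" if "N \<le> n" "n \<le> m" for n m
    using that \<kappa> growth by (intro geometric_growth_le) (auto simp: \<kappa>_def)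
  have mono: "x n \<le> x m" if "N \<le> n" "n \<le> m" for n m
  proof -
    have "\<kappa> ^ (m - n) * x m \<le> 1 * x m"
      using \<kappa> x0[of m] by (intro mult_right_mono power_le_one) auto
    with gr[OF that] show ?thesis by simp
  qed
  \<comment> \<open>The \<open>n\<close>-th measure gives \<open>{0..c m}\<close> the mass
    \<open>exp (- (x n)\<^sup>2 / (x m * x (Suc m)))\<close>. The geometric mean in the denominator
    makes this small for \<open>n > m\<close> and close to 1 for \<open>n \<le> m\<close>.\<close>
  define c where "c m = exp (- 1 / (x m * x (Suc m)))" for m
  have c: "0 \<le> c m" "c m \<le> 1" for m unfolding c_def using x0 by (auto simp: less_imp_le)
  have c_mono: "c m \<le> c k" if "N \<le> m" "m \<le> k" for m k
    unfolding c_def using that x0 by (auto intro!: divide_left_mono mult_mono mono simp: less_imp_le)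
  \<comment> \<open>The first piece has no lower cut and the last no upper one, so that the pieces
    cover \<open>{0..1}\<close>. The truncated \<open>m - 1\<close> matters only for
    \<open>m \<noteq> N\<close>, where, in the range used, it is the true predecessor.\<close>
  define A where "A m = {t\<in>{0..1}. (m \<noteq> N \<longrightarrow> c (m - 1) < t) \<and> (Suc m \<noteq> K \<longrightarrow> t \<le> c m)}" for m
  let ?M = "lebesgue_on {0..1::real}"
  let ?f = "\<lambda>n. normalized_monomial p (lam n)"
  have A_sets: "A m \<in> sets ?M" for m
  proof -
    have "A m \<in> sets borel" unfolding A_def by measurable
    then show ?thesis by (subst sets_restrict_space_iff) (auto simp: A_def)
  qed
  have int_ind: "integrable ?M (\<lambda>t. indicator B t * norm (?f n t) powr p)" if "B \<in> sets ?M" for B n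
    using integrable_mult_indicator[OF that Lp_space_integrable[OF normalized_monomial_Lp(1)[OF _ lam[of n]]]] p
    by simp
  have cut: "integrable ?M (\<lambda>t. indicator {0..c m} t * norm (?f n t) powr p)"
    "(\<integral>t. indicator {0..c m} t * norm (?f n t) powr p \<partial>?M) = exp (- (x n * x n) / (x m * x (Suc m)))" for n m
    using has_bochner_integral_normalized_monomial[of p "lam n" "c m"] p lam[of n] c[of m]
    by (auto simp: has_bochner_integral_iff sq c_def exp_powr_real)
  have off: "(\<integral>t. indicator (A m) t * norm (?f n t) powr p \<partial>?M) \<le> (q ^ ((n - m) + (m - n))) powr p"
    if n: "n \<in> {N..<K}" and m: "m \<in> {N..<K}" and "n \<noteq> m" for n m
  proof -
    have "(q ^ d) powr p = \<kappa> ^ d" for d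
      unfolding \<kappa>_def using q p by (simp add: powr_powr mult.commute flip: powr_realpow)
    moreover have "(\<integral>t. indicator (A m) t * norm (?f n t) powr p \<partial>?M) \<le> \<kappa> ^ ((n - m) + (m - n))"
    proof (cases "m < n")
      case True
      \<comment> \<open>Since \<open>m < n < K\<close>, the upper cut of \<open>A m\<close> is
        present. The tail is then estimated by \<open>exp (- y) \<le> 1 / y\<close>.\<close>
      have "(\<integral>t. indicator (A m) t * norm (?f n t) powr p \<partial>?M)
          \<le> (\<integral>t. indicator {0..c m} t * norm (?f n t) powr p \<partial>?M)"
        using True n by (intro integral_mono int_ind A_sets cut) (auto simp: A_def indicator_def)
      also have "\<dots> = exp (- (x n * x n) / (x m * x (Suc m)))" by (rule cut)
      also have "\<dots> \<le> (x m * x (Suc m)) / (x n * x n)"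
        using exp_ge_add_one_self[of "(x n * x n) / (x m * x (Suc m))"] x0[of n] x0[of m] x0[of "Suc m"]
        by (auto simp: exp_minus field_simps intro: order_trans[rotated])
      also have "\<dots> \<le> x m / x n"
        using mono[of "Suc m" n] True m x0[of n] x0[of m] by (simp add: field_simps)
      also have "\<dots> \<le> \<kappa> ^ (n - m)"
        using gr[of m n] True m x0[of n] by (simp add: field_simps)
      finally show ?thesis using True by simp
    next
      case False
      with \<open>n \<noteq> m\<close> have nm: "n < m" by simp
      then obtain k where k: "m = Suc k" by (cases m) auto
      \<comment> \<open>Since \<open>N \<le> n < m\<close>, the lower cut \<open>c k\<close> of
        \<open>A m\<close> is present. The complementary mass is estimated by
        \<open>1 - exp (- y) \<le> y\<close>.\<close>
      have "(\<integral>t. indicator (A m) t * norm (?f n t) powr p \<partial>?M)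
          \<le> (\<integral>t. norm (?f n t) powr p - indicator {0..c k} t * norm (?f n t) powr p \<partial>?M)"
        using nm n k lam p
        by (intro integral_mono int_ind A_sets cut Bochner_Integration.integrable_diff
            Lp_space_integrable normalized_monomial_Lp) (auto simp: A_def indicator_def)
      also have "\<dots> = 1 - exp (- (x n * x n) / (x k * x (Suc k)))"
        using p lam by (simp add: cut Lp_space_integrable normalized_monomial_Lp)
      also have "\<dots> \<le> (x n * x n) / (x k * x m)"
        using exp_ge_add_one_self[of "- (x n * x n) / (x k * x m)"] k by simp
      also have "\<dots> \<le> x n / x m"
        using mono[of n k] nm n k x0[of n] x0[of m] x0[of k] by (simp add: field_simps)
      also have "\<dots> \<le> \<kappa> ^ (m - n)"
        using gr[of n m] nm n x0[of m] by (simp add: field_simps)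
      finally show ?thesis using nm by simp
    qed
    ultimately show ?thesis by simp
  qed
  have disj: "A m \<inter> A k = {}" if "N \<le> m" "m < k" "k < K" for m k
  proof -
    have "m \<le> k - 1" using that by simp
    then show ?thesis using that c_mono[of m "k - 1"] by (fastforce simp: A_def)
  qed
  have "disjoint_family_on A {N..<K}"
    unfolding disjoint_family_on_def
  proof (intro ballI impI)
    fix m k assume "m \<in> {N..<K}" "k \<in> {N..<K}" "m \<noteq> k"
    then show "A m \<inter> A k = {}" using disj[of m k] disj[of k m] by (cases "m < k") auto
  qed
  moreover have "(\<Union>m\<in>{N..<K}. A m) = space ?M"
  proof -
    have "\<exists>m\<in>{N..<K}. t \<in> A m" if t: "t \<in> {0..1}" for t
    proof -
      \<comment> \<open>The piece containing \<open>t\<close> is the first one whose upper cut is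
        not exceeded; minimality yields its lower cut. The last index always satisfies
        \<open>P\<close>.\<close>
      define P where "P = (\<lambda>m. N \<le> m \<and> (Suc m = K \<or> t \<le> c m))"
      have P: "P (K - 1)" using \<open>N < K\<close> by (auto simp: P_def)
      define m where "m = (LEAST m. P m)"
      have Pm: "P m" unfolding m_def using P by (rule LeastI)
      have "m \<le> K - 1" unfolding m_def using P by (rule Least_le)
      moreover have "c (m - 1) < t" if "m \<noteq> N"
      proof -
        have "\<not> P (m - 1)" using that Pm not_less_Least[of "m - 1" P] by (auto simp: m_def P_def)
        then show ?thesis using that Pm by (auto simp: P_def)
      qed
      ultimately show ?thesis using Pm t \<open>N < K\<close> by (intro bexI[of _ m]) (auto simp: A_def P_def)
    qed
    then show ?thesis by (auto simp: A_def)
  qed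
  moreover have row: "(\<Sum>m\<in>{N..<K}-{n}. q ^ ((n - m) + (m - n))) \<le> W" for n
    using sum_power_dist_le[OF q(1,2), of "{N..<K}" n] q(3) by simp
  moreover have "(\<Sum>n\<in>{N..<K}-{m}. q ^ ((n - m) + (m - n))) \<le> W" for m
    using row[of m] by (simp only: add.commute)
  moreover have "0 < W" using q by (auto intro: less_le_trans[rotated])
  ultimately show "(1 - 2 * W) * R \<le> nrm" "nrm \<le> (1 + W) * R"
    unfolding R_def nrm_def using p q
    by (intro Lp_norm_almost_disjoint[where A = A and w = "\<lambda>n m. q ^ ((n - m) + (m - n))"]
        normalized_monomial_Lp lam A_sets off; simp add: power_le_one)+
qed

section \<open>Super-lacunary exponents\<close>

text \<open>For \<open>x \<le> y\<close>, write \<open>(x + y) powr p\<close> as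
  \<open>(x + y) * (x + y) powr (p - 1)\<close> and expand the first factor. In the term with
  \<open>x\<close> the base \<open>x + y\<close> is at least \<open>2 * x\<close>, in the term with
  \<open>y\<close> it is at least \<open>y\<close>; the surplus is \<open>2 powr (p - 1) - 1\<close>
  times \<open>x powr p\<close>.\<close>

lemma powr_add_ge:
  fixes x y z :: real
  assumes p: "1 \<le> p" and "0 \<le> x" "0 \<le> y" "z \<le> x powr p" "z \<le> y powr p"
  shows "x powr p + y powr p + (2 powr (p - 1) - 1) * z \<le> (x + y) powr p"
  using assms(2-)
proof (induction x y rule: linorder_wlog)
  case (sym x y)
  then show ?case by (simp add: add.commute)
next
  case (le x y)
  have C: "0 \<le> 2 powr (p - 1) - (1::real)" using p by (simp add: ge_one_powr_ge_zero)
  have pw: "u powr p = u * u powr (p - 1)" if "0 \<le> u" for u :: real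
    using that powr_mult_base[of u "p - 1"] by simp
  have "x powr p + (2 powr (p - 1) - 1) * z \<le> x powr p + (2 powr (p - 1) - 1) * x powr p"
    using C le by (intro add_left_mono mult_left_mono) auto
  also have "\<dots> = x * (x + x) powr (p - 1)"
    using le pw[of x] by (simp add: algebra_simps powr_mult flip: mult_2)
  also have "\<dots> \<le> x * (x + y) powr (p - 1)"
    using le p by (intro mult_left_mono powr_mono2) auto
  finally have *: "x powr p + (2 powr (p - 1) - 1) * z \<le> x * (x + y) powr (p - 1)" .
  have "y powr p = y * y powr (p - 1)" using le by (intro pw)
  also have "\<dots> \<le> y * (x + y) powr (p - 1)"
    using le p by (intro mult_left_mono powr_mono2) auto
  finally show ?case using * le pw[of "x + y"] by (simp add: algebra_simps)
qed

text \<open>Both values are non-negative reals, so nothing cancels.\<close>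

lemma norm_normalized_monomial_add:
  "norm (normalized_monomial p r t + normalized_monomial p s t)
    = norm (normalized_monomial p r t) + norm (normalized_monomial p s t)"
  unfolding normalized_monomial_def monomial_def
  by (simp flip: of_real_divide of_real_add)

text \<open>On the unit interval \<open>(r * p + 1) * t powr (s * p)\<close> lies below both
  densities, because \<open>r \<le> s\<close>. It serves as \<open>z\<close> in
  \<open>powr_add_ge\<close>, and its integral is the quotient in the bound.\<close>

lemma normalized_monomial_add_ge:
  assumes p: "1 < p" and "0 \<le> r" "r \<le> s"
  shows "2 + (2 powr (p - 1) - 1) * ((r * p + 1) / (s * p + 1))
    \<le> Lp_norm p (lebesgue_on {0..1}) (\<lambda>t. normalized_monomial p r t + normalized_monomial p s t) powr p"
proof -
  let ?M = "lebesgue_on {0..1::real}" and ?f = "normalized_monomial p r" and ?g = "normalized_monomial p s"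
  let ?C = "2 powr (p - 1) - (1::real)"
  define \<mu> where "\<mu> = r * p + 1"
  define \<nu> where "\<nu> = s * p + 1"
  define h where "h = (\<lambda>t::real. indicator {0..1} t * t powr (s * p))"
  have \<mu>: "0 < \<mu>" "\<mu> \<le> \<nu>" unfolding \<mu>_def \<nu>_def using assms by (auto simp: add_nonneg_pos)
  have L: "?f \<in> Lp_space p ?M" "?g \<in> Lp_space p ?M"
    "(\<integral>t. norm (?f t) powr p \<partial>?M) = 1" "(\<integral>t. norm (?g t) powr p \<partial>?M) = 1"
    using normalized_monomial_Lp[of p r] normalized_monomial_Lp[of p s] assms by auto
  have h: "integrable ?M h" "integral\<^sup>L ?M h = 1 / \<nu>"
    using has_bochner_integral_powr[of "s * p" 1] assms
    by (auto simp: has_bochner_integral_iff h_def \<nu>_def)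
  have "2 + ?C * (\<mu> / \<nu>) = (\<integral>t. norm (?f t) powr p + norm (?g t) powr p + ?C * (\<mu> * h t) \<partial>?M)"
    using h L(3,4) Lp_space_integrable[OF L(1)] Lp_space_integrable[OF L(2)] by simp
  also have "\<dots> \<le> (\<integral>t. norm (?f t + ?g t) powr p \<partial>?M)"
  proof (intro integral_mono Bochner_Integration.integrable_add integrable_mult_right h
      Lp_space_integrable L Lp_space_add)
    show "norm (?f t) powr p + norm (?g t) powr p + ?C * (\<mu> * h t) \<le> norm (?f t + ?g t) powr p"
      if "t \<in> space ?M" for t
      unfolding norm_normalized_monomial_add
    proof (rule powr_add_ge)
      have t: "0 \<le> t" "t \<le> 1" using that by auto
      have "t powr (s * p) \<le> t powr (r * p)"
        using t assms by (cases "t = 0") (auto intro!: powr_mono')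
      then show "\<mu> * h t \<le> norm (?f t) powr p" "\<mu> * h t \<le> norm (?g t) powr p"
        using assms t \<mu> by (auto simp: norm_normalized_monomial_powr h_def \<mu>_def \<nu>_def intro!: mult_mono)
    qed (use p in auto)
  qed (use p in auto)
  finally show ?thesis using p by (simp add: Lp_norm_powr \<mu>_def \<nu>_def)
qed

section \<open>The two implications\<close>

lemma super_lacunary_imp_asymptotically_isometric:
  fixes p :: real and lam :: "nat \<Rightarrow> real"
  assumes p: "1 < p" and mono: "strict_mono lam" and lam: "\<And>n. 0 \<le> lam n"
    and sl: "super_lacunary lam"
  shows "asymptotically_isometric_lp p (Lp_space p (lebesgue_on {0..1}))
      (Lp_norm p (lebesgue_on {0..1})) (\<lambda>n. normalized_monomial p (lam n))"
  unfolding asymptotically_isometric_lp_def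
proof (intro conjI allI ballI)
  fix n
  show "normalized_monomial p (lam n) \<in> Lp_space p (lebesgue_on {0..1})"
    using p lam by (intro normalized_monomial_Lp) auto
  show "Lp_norm p (lebesgue_on {0..1}) (normalized_monomial p (lam n)) = 1"
    using normalized_monomial_Lp(2)[of p "lam n"] p lam by (simp add: Lp_norm_def)
next
  fix \<epsilon> :: real assume \<epsilon>: "\<epsilon> \<in> {0<..<1}"
  \<comment> \<open>This gives \<open>2 * q / (1 - q) \<le> W\<close> for
    \<open>W = \<epsilon> / 2\<close>, and \<open>1 - 2 * W\<close> is then exactly
    \<open>1 - \<epsilon>\<close>.\<close>
  define q where "q = \<epsilon> / 8"
  define x where "x n = sqrt (p * lam n + 1)" for n
  define \<kappa> where "\<kappa> = q powr p"
  have q: "0 < q" "q < 1" "2 * q / (1 - q) \<le> \<epsilon> / 2"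
    using \<epsilon> by (auto simp: q_def field_simps)
  have \<kappa>: "0 < \<kappa>" using q by (simp add: \<kappa>_def)
  have lam1: "0 < lam 1" using lam[of 0] strict_monoD[OF mono, of 0 1] by simp
  \<comment> \<open>The term \<open>1 / lam 1\<close> absorbs the summand 1 in
    \<open>p * lam n + 1\<close>, since \<open>lam n \<ge> lam 1\<close>; the square of
    \<open>\<kappa>\<close> appears because \<open>x n\<close> is a square root.\<close>
  define B where "B = (p + 1 / lam 1) / (\<kappa>\<^sup>2 * p)"
  have "eventually (\<lambda>n. B \<le> lam (Suc n) / lam n) sequentially"
    using sl by (simp add: super_lacunary_def filterlim_at_top)
  then obtain N0 where N0: "\<And>n. N0 \<le> n \<Longrightarrow> B \<le> lam (Suc n) / lam n"
    by (auto simp: eventually_sequentially)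
  \<comment> \<open>The shift forces \<open>n \<ge> 1\<close>, hence \<open>lam n > 0\<close>;
    \<open>lam 0\<close> may vanish, and division by it would give 0.\<close>
  define N where "N = Suc N0"
  have growth: "x n \<le> q powr p * x (Suc n)" if "N \<le> n" for n
  proof -
    have l: "lam 1 \<le> lam n"
      using strict_mono_mono[OF mono] that by (auto simp: N_def monoD)
    have "p * lam n + 1 \<le> (p + 1 / lam 1) * lam n"
      using l lam1 by (simp add: algebra_simps)
    also have "\<dots> = \<kappa>\<^sup>2 * p * (B * lam n)"
      using \<kappa> p by (simp add: B_def)
    also have "\<dots> \<le> \<kappa>\<^sup>2 * p * lam (Suc n)"
      using N0[of n] that l lam1 \<kappa> p by (intro mult_left_mono) (auto simp: N_def field_simps)
    also have "\<dots> \<le> \<kappa>\<^sup>2 * (p * lam (Suc n) + 1)" by (simp add: algebra_simps)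
    finally have "x n \<le> sqrt (\<kappa>\<^sup>2 * (p * lam (Suc n) + 1))"
      unfolding x_def by (rule real_sqrt_le_mono)
    then show ?thesis using \<kappa> by (simp add: real_sqrt_mult x_def \<kappa>_def)
  qed
  show "\<exists>N. \<forall>a\<in>c00.
        (1 - \<epsilon>) * (\<Sum>n | N \<le> n \<and> a n \<noteq> 0. norm (a n) powr p) powr (1 / p)
          \<le> Lp_norm p (lebesgue_on {0..1}) (\<lambda>t. \<Sum>n | N \<le> n \<and> a n \<noteq> 0. a n * normalized_monomial p (lam n) t) \<and>
        Lp_norm p (lebesgue_on {0..1}) (\<lambda>t. \<Sum>n | N \<le> n \<and> a n \<noteq> 0. a n * normalized_monomial p (lam n) t)
          \<le> (1 + \<epsilon>) * (\<Sum>n | N \<le> n \<and> a n \<noteq> 0. norm (a n) powr p) powr (1 / p)"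
  proof (intro exI[of _ N] ballI)
    fix a assume "a \<in> c00"
    then have fin: "finite {n. a n \<noteq> 0}" by (simp add: c00_def)
    then obtain K0 where K0: "\<And>n. a n \<noteq> 0 \<Longrightarrow> n < K0"
      unfolding finite_nat_set_iff_bounded by blast
    \<comment> \<open>The support is filled up with zero coefficients to an interval of consecutive
      indices, as the partition requires; \<open>Suc N\<close> keeps it nonempty.\<close>
    define K where "K = max K0 (Suc N)"
    have sums: "(\<Sum>n | N \<le> n \<and> a n \<noteq> 0. g n) = (\<Sum>n\<in>{N..<K}. g n)"
      if "\<And>n. a n = 0 \<Longrightarrow> g n = 0" for g :: "nat \<Rightarrow> 'b :: comm_monoid_add"
      using that K0 by (intro sum.mono_neutral_left) (auto simp: K_def less_max_iff_disj)
    have R: "(\<Sum>n | N \<le> n \<and> a n \<noteq> 0. norm (a n) powr p) = (\<Sum>n\<in>{N..<K}. norm (a n) powr p)"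
      by (rule sums) simp
    have F: "(\<Sum>n | N \<le> n \<and> a n \<noteq> 0. a n * normalized_monomial p (lam n) t)
       = (\<Sum>n\<in>{N..<K}. a n * normalized_monomial p (lam n) t)" for t
      by (rule sums) simp
    have iso: "(1 - 2 * (\<epsilon> / 2)) * (\<Sum>n\<in>{N..<K}. norm (a n) powr p) powr (1/p)
        \<le> Lp_norm p (lebesgue_on {0..1}) (\<lambda>t. \<Sum>n\<in>{N..<K}. a n * normalized_monomial p (lam n) t)"
      "Lp_norm p (lebesgue_on {0..1}) (\<lambda>t. \<Sum>n\<in>{N..<K}. a n * normalized_monomial p (lam n) t)
        \<le> (1 + \<epsilon> / 2) * (\<Sum>n\<in>{N..<K}. norm (a n) powr p) powr (1/p)"
      using lacunary_monomials_almost_isometric[OF p lam x_def q, where N = N and K = K and a = a] growth \<epsilon>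
      by (auto simp: K_def)
    moreover have "(1 + \<epsilon> / 2) * (\<Sum>n\<in>{N..<K}. norm (a n) powr p) powr (1/p)
        \<le> (1 + \<epsilon>) * (\<Sum>n\<in>{N..<K}. norm (a n) powr p) powr (1/p)"
      using \<epsilon> by (intro mult_right_mono) auto
    ultimately show "(1 - \<epsilon>) * (\<Sum>n | N \<le> n \<and> a n \<noteq> 0. norm (a n) powr p) powr (1 / p)
          \<le> Lp_norm p (lebesgue_on {0..1}) (\<lambda>t. \<Sum>n | N \<le> n \<and> a n \<noteq> 0. a n * normalized_monomial p (lam n) t) \<and>
        Lp_norm p (lebesgue_on {0..1}) (\<lambda>t. \<Sum>n | N \<le> n \<and> a n \<noteq> 0. a n * normalized_monomial p (lam n) t)
          \<le> (1 + \<epsilon>) * (\<Sum>n | N \<le> n \<and> a n \<noteq> 0. norm (a n) powr p) powr (1 / p)"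
      unfolding R F by auto
  qed
qed

text \<open>The upper estimate is tested on the sum of two consecutive functions, whose
  \<open>p\<close>-th power norm exceeds 2 by at least a multiple of the quotient of
  \<open>lam n * p + 1\<close> by its successor. A small \<open>\<epsilon>\<close> leaves no room
  unless that quotient is small.\<close>

lemma asymptotically_isometric_imp_super_lacunary:
  fixes p :: real and lam :: "nat \<Rightarrow> real"
  assumes p: "1 < p" and mono: "strict_mono lam" and lam: "\<And>n. 0 \<le> lam n"
    and ai: "asymptotically_isometric_lp p (Lp_space p (lebesgue_on {0..1}))
      (Lp_norm p (lebesgue_on {0..1})) (\<lambda>n. normalized_monomial p (lam n))"
  shows "super_lacunary lam"
  unfolding super_lacunary_def
proof (subst filterlim_at_top_gt[of _ _ 1], intro allI impI)
  fix Z :: real assume Z: "1 < Z"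
  define C :: real where "C = 2 powr (p - 1) - 1"
  have C: "0 < C" using p by (simp add: C_def)
  \<comment> \<open>Continuity at 0 supplies an \<open>\<epsilon>\<close> for which the isometric
    bound stays below \<open>2 + C / Z\<close>.\<close>
  have "((\<lambda>\<epsilon>. 2 * (1 + \<epsilon>) powr p) \<longlongrightarrow> 2 * (1 + 0) powr p) (at_right (0::real))"
    by (intro tendsto_intros) auto
  moreover have "2 * (1 + 0) powr p < 2 + C / Z" using C Z by simp
  ultimately have "eventually (\<lambda>\<epsilon>. 2 * (1 + \<epsilon>) powr p < 2 + C / Z) (at_right (0::real))"
    by (rule order_tendstoD)
  moreover have "eventually (\<lambda>\<epsilon>. \<epsilon> \<in> {0<..<1}) (at_right (0::real))"
    by (rule eventually_at_right_real) simp
  ultimately have "eventually (\<lambda>\<epsilon>. 2 * (1 + \<epsilon>) powr p < 2 + C / Z \<and> \<epsilon> \<in> {0<..<1}) (at_right (0::real))"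
    by eventually_elim simp
  then obtain \<epsilon> :: real where \<epsilon>: "2 * (1 + \<epsilon>) powr p < 2 + C / Z" "\<epsilon> \<in> {0<..<1}"
    using eventually_happens trivial_limit_at_right_real by blast
  with ai obtain N where N: "\<And>a. a \<in> c00 \<Longrightarrow>
      Lp_norm p (lebesgue_on {0..1}) (\<lambda>t. \<Sum>n | N \<le> n \<and> a n \<noteq> 0. a n * normalized_monomial p (lam n) t)
        \<le> (1 + \<epsilon>) * (\<Sum>n | N \<le> n \<and> a n \<noteq> 0. norm (a n) powr p) powr (1 / p)"
    unfolding asymptotically_isometric_lp_def by blast
  \<comment> \<open>Starting at \<open>Suc N\<close> excludes \<open>n = 0\<close>, so that the
    denominator \<open>lam n\<close> is positive.\<close>
  have "Z \<le> lam (Suc n) / lam n" if n: "Suc N \<le> n" for n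
  proof -
    define a :: "nat \<Rightarrow> complex" where "a k = (if k = n \<or> k = Suc n then 1 else 0)" for k
    have supp: "{k. N \<le> k \<and> a k \<noteq> 0} = {n, Suc n}" using n by (auto simp: a_def)
    have "{k. a k \<noteq> 0} = {n, Suc n}" by (auto simp: a_def)
    then have "a \<in> c00" by (simp add: c00_def)
    from N[OF this] have le: "Lp_norm p (lebesgue_on {0..1})
        (\<lambda>t. normalized_monomial p (lam n) t + normalized_monomial p (lam (Suc n)) t) \<le> (1 + \<epsilon>) * 2 powr (1 / p)"
      unfolding supp by (simp add: a_def)
    have l: "0 < lam n" "lam n < lam (Suc n)"
      using lam[of 0] strict_monoD[OF mono, of 0 n] strict_monoD[OF mono, of n "Suc n"] n by auto
    have pos: "0 < lam (Suc n) * p + 1" using l p by (intro add_pos_pos mult_pos_pos) auto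
    have "2 + C * ((lam n * p + 1) / (lam (Suc n) * p + 1)) \<le> Lp_norm p (lebesgue_on {0..1})
        (\<lambda>t. normalized_monomial p (lam n) t + normalized_monomial p (lam (Suc n)) t) powr p"
      unfolding C_def using p l by (intro normalized_monomial_add_ge) auto
    also have "\<dots> \<le> ((1 + \<epsilon>) * 2 powr (1 / p)) powr p"
      using le p by (intro powr_mono2) auto
    also have "\<dots> = 2 * (1 + \<epsilon>) powr p"
      using p \<epsilon> by (simp add: powr_mult powr_powr)
    also have "\<dots> < 2 + C / Z" by (rule \<epsilon>)
    finally have "C * ((lam n * p + 1) / (lam (Suc n) * p + 1)) < C * (1 / Z)" by simp
    then have "(lam n * p + 1) / (lam (Suc n) * p + 1) < 1 / Z" using C by (simp only: mult_less_cancel_left_pos)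
    then have "Z * (lam n * p + 1) < lam (Suc n) * p + 1" using pos Z by (simp add: field_simps)
    then have "p * (Z * lam n) \<le> p * lam (Suc n)" using Z by (simp add: algebra_simps)
    then show ?thesis using p l by (simp add: field_simps)
  qed
  then show "eventually (\<lambda>n. Z \<le> lam (Suc n) / lam n) sequentially"
    by (auto simp: eventually_sequentially)
qed

theorem corollary3p8:
  fixes p :: real and lam :: "nat \<Rightarrow> real"
  assumes "1 < p"
    and "strict_mono lam"
    and "\<And>n. 0 \<le> lam n"
    and "summable (\<lambda>n. 1 / lam (Suc n))"
    and "(INF n. lam (Suc n) - lam n) > 0"
  shows "super_lacunary lam \<longleftrightarrow>
    asymptotically_isometric_lp p (Lp_space p (lebesgue_on {0..1}))
      (Lp_norm p (lebesgue_on {0..1})) (\<lambda>n. normalized_monomial p (lam n))"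
  using super_lacunary_imp_asymptotically_isometric[OF assms(1-3)]
    asymptotically_isometric_imp_super_lacunary[OF assms(1-3)] by blast

end
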